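(* Let $\sigma\ge 0$. Let $\mathcal{D}_0$ be the set of continuous functions $g:\mathbb{R}\to\mathbb{R}$ for which there exist constants $\varsigma_g>0$ and $M_g$ with $\varsigma_g<g(t)-\sigma<M_g$ for all $t\in\mathbb{R}$, and for $g\in\mathcal{D}_0$ let $\Phi_g:\mathbb{R}\to\mathbb{R}$ be the firing map of the model $\dot{x}=-\sigma x+g(t)$. Then the mapping $f\mapsto\Phi_f$ is continuous from the $C^0(\mathbb{R})$-topology into the $C^1(\mathbb{R})$-topology at every $f\in\mathcal{D}_0$; that is, for every $f\in\mathcal{D}_0$ and every $\varepsilon>0$ there is $\delta>0$ such that for all $g\in\mathcal{D}_0$, $d_{C^0(\mathbb{R})}(f,g)<\delta$ implies $d_{C^1(\mathbb{R})}(\Phi_f,\Phi_g)<\varepsilon$.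
   Context: Firing map: for $\sigma\ge 0$ and $g\in L^1_{\mathrm{loc}}(\mathbb{R})$, the firing map of $\dot{x}=-\sigma x+g(t)$ (reset value $0$, threshold $1$) is $\Phi_g(t):=\inf\{t_*>t:\ e^{\sigma t}\le\int_t^{t_*}[g(u)-\sigma]e^{\sigma u}\,du\}$. For $g\in\mathcal{D}_0$ it is defined on all of $\mathbb{R}$ and is continuously differentiable. For $m\in\{0,1\}$, $C^m(\mathbb{R})$ is the space of $m$-times continuously differentiable functions $\mathbb{R}\to\mathbb{R}$ with metric $d_{C^m(\mathbb{R})}(f,g)=\sum_{k\ge1}2^{-k}\frac{\|f-g\|_{C^m([-k,k])}}{1+\|f-g\|_{C^m([-k,k])}}$, where $\|f\|_{C^m([-k,k])}=\max_{0\le j\le m}\sup_{t\in[-k,k]}|f^{(j)}(t)|$. *)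

theory Defs
  imports "HOL-Analysis.Analysis"
begin

text \<open>
  The gauge integral agrees with the Lebesgue integral on locally integrable functions.
  The infimum is only meaningful when the set of admissible times is nonempty,
  as is the case for every input in the class \<open>input_class\<close> below.
\<close>

definition firing_map :: "real \<Rightarrow> (real \<Rightarrow> real) \<Rightarrow> real \<Rightarrow> real" where
  "firing_map \<sigma> g t =
     Inf {s. s > t \<and> exp (\<sigma> * t) \<le> integral {t..s} (\<lambda>u. (g u - \<sigma>) * exp (\<sigma> * u))}"

definition input_class :: "real \<Rightarrow> (real \<Rightarrow> real) set" where
  "input_class \<sigma> = {g. continuous_on UNIV g \<and>
     (\<exists>\<zeta>>0. \<exists>M. \<forall>t. \<zeta> < g t - \<sigma> \<and> g t - \<sigma> < M)}"

definition C_space :: "nat \<Rightarrow> (real \<Rightarrow> real) set" where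
  "C_space m = {f.
     (\<forall>j<m. \<forall>t. ((deriv ^^ j) f) differentiable (at t)) \<and>
     (\<forall>j\<le>m. continuous_on UNIV ((deriv ^^ j) f))}"

text \<open>
  The next two definitions are intended for functions in \<open>C_space m\<close> only: there all the suprema
  are of bounded sets and the iterated \<open>deriv\<close> is the genuine derivative.
\<close>

definition C_norm :: "nat \<Rightarrow> nat \<Rightarrow> (real \<Rightarrow> real) \<Rightarrow> real" where
  "C_norm m k f = (MAX j\<in>{..m}. SUP t\<in>{- real k..real k}. \<bar>(deriv ^^ j) f t\<bar>)"

text \<open>The sum ranges over \<open>k \<ge> 1\<close>, hence the index shift.\<close>

definition C_dist :: "nat \<Rightarrow> (real \<Rightarrow> real) \<Rightarrow> (real \<Rightarrow> real) \<Rightarrow> real" where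
  "C_dist m f g =
     (\<Sum>k. (1 / 2) ^ Suc k *
        (C_norm m (Suc k) (\<lambda>t. f t - g t) / (1 + C_norm m (Suc k) (\<lambda>t. f t - g t))))"

end

theory Submission
  imports Defs
begin

text \<open>
  With an antiderivative \<open>G\<close> of \<open>(g - \<sigma>) exp (\<sigma> \<cdot>)\<close>, which is strictly increasing, the firing time
  is the unique solution of \<open>G (\<Phi> t) = G t + exp (\<sigma> t)\<close>. The inverse function theorem gives
  \<open>\<Phi>' t = g t exp (\<sigma> (t - \<Phi> t)) / (g (\<Phi> t) - \<sigma>)\<close>. The lower bound \<open>\<zeta> < f - \<sigma>\<close> confines
  \<open>\<Phi>\<^sub>g t\<close> to \<open>[t, t + 2/\<zeta>]\<close> for all \<open>g\<close> close to \<open>f\<close> there, and bounds \<open>\<bar>\<Phi>\<^sub>f t - \<Phi>\<^sub>g t\<bar>\<close> by a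
  multiple of the distance of \<open>f\<close> and \<open>g\<close> on this interval. So \<open>\<Phi>\<^sub>g \<rightarrow> \<Phi>\<^sub>f\<close> locally uniformly, and
  the formula for \<open>\<Phi>'\<close> then passes to the limit.
\<close>

section \<open>The topology of the spaces of continuously differentiable functions\<close>

text \<open>\<open>deriv\<close> is additive only where the derivatives exist; membership in
  \<open>C_space m\<close> guarantees this at each order below \<open>m\<close>, so the induction
  reaches every \<open>j \<le> m\<close>.\<close>

lemma C_space_diff:
  assumes "f \<in> C_space m" "g \<in> C_space m"
  shows "(\<lambda>t. f t - g t) \<in> C_space m"
    and "j \<le> m \<Longrightarrow> (deriv ^^ j) (\<lambda>t. f t - g t) = (\<lambda>t. (deriv ^^ j) f t - (deriv ^^ j) g t)"
proof -
  have D: "(deriv ^^ j) (\<lambda>t. f t - g t) = (\<lambda>t. (deriv ^^ j) f t - (deriv ^^ j) g t)"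
    if "j \<le> m" for j
    using that
  proof (induction j)
    case (Suc j)
    have "(deriv ^^ j) f field_differentiable at t" "(deriv ^^ j) g field_differentiable at t" for t
      using assms Suc.prems unfolding C_space_def
      by (auto simp: real_differentiable_def field_differentiable_def)
    then show ?case
      using Suc.IH Suc.prems by simp
  qed simp
  then show "j \<le> m \<Longrightarrow> (deriv ^^ j) (\<lambda>t. f t - g t) = (\<lambda>t. (deriv ^^ j) f t - (deriv ^^ j) g t)" .
  show "(\<lambda>t. f t - g t) \<in> C_space m"
    using assms D unfolding C_space_def
    by (auto intro!: derivative_intros continuous_intros)
qed

text \<open>Compactness bounds the set of values; over the reals \<open>SUP\<close> is sure to
  dominate the members only of a set bounded above.\<close>

lemma abs_deriv_le_C_norm:
  assumes "f \<in> C_space m" "j \<le> m" "t \<in> {- real k..real k}"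
  shows "\<bar>(deriv ^^ j) f t\<bar> \<le> C_norm m k f"
proof -
  have "continuous_on {- real k..real k} (\<lambda>t. \<bar>(deriv ^^ j) f t\<bar>)"
    using assms unfolding C_space_def
    by (auto intro!: continuous_intros intro: continuous_on_subset)
  then have "bdd_above ((\<lambda>t. \<bar>(deriv ^^ j) f t\<bar>) ` {- real k..real k})"
    by (intro bounded_imp_bdd_above compact_imp_bounded compact_continuous_image) auto
  then have "\<bar>(deriv ^^ j) f t\<bar> \<le> (SUP t\<in>{- real k..real k}. \<bar>(deriv ^^ j) f t\<bar>)"
    using assms by (intro cSUP_upper) auto
  also have "\<dots> \<le> C_norm m k f"
    unfolding C_norm_def using assms by (intro Max_ge) auto
  finally show ?thesis .
qed

lemma C_norm_le:
  assumes "\<And>j t. j \<le> m \<Longrightarrow> t \<in> {- real k..real k} \<Longrightarrow> \<bar>(deriv ^^ j) f t\<bar> \<le> e"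
  shows "C_norm m k f \<le> e"
proof -
  have "(SUP t\<in>{- real k..real k}. \<bar>(deriv ^^ j) f t\<bar>) \<le> e" if "j \<le> m" for j
    using assms that by (intro cSUP_least) auto
  then show ?thesis
    unfolding C_norm_def by auto
qed

lemma C_norm_nonneg:
  assumes "f \<in> C_space m"
  shows "0 \<le> C_norm m k f"
  using abs_deriv_le_C_norm[OF assms, of 0 0 k] by auto

text \<open>The geometric majorant is the same for all functions: it makes the series converge and
  later dominates it when limit and sum are exchanged.\<close>

lemma C_dist_term_bounds:
  fixes k :: nat
  assumes "f \<in> C_space m" "g \<in> C_space m"
  defines "N \<equiv> C_norm m (Suc k) (\<lambda>t. f t - g t)"
  shows "0 \<le> (1/2) ^ Suc k * (N / (1 + N))"
    and "norm ((1/2) ^ Suc k * (N / (1 + N))) \<le> (1/2) ^ Suc k"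
proof -
  have "0 \<le> N"
    unfolding N_def by (intro C_norm_nonneg C_space_diff assms)
  then have "0 \<le> N / (1 + N)" "N / (1 + N) \<le> 1"
    by auto
  then have "0 \<le> (1/2) ^ Suc k * (N / (1 + N))" "(1/2) ^ Suc k * (N / (1 + N)) \<le> (1/2) ^ Suc k"
    by (intro mult_nonneg_nonneg mult_left_le; simp)+
  then show "0 \<le> (1/2) ^ Suc k * (N / (1 + N))"
    and "norm ((1/2) ^ Suc k * (N / (1 + N))) \<le> (1/2) ^ Suc k"
    by (simp_all only: real_norm_def abs_of_nonneg)
qed

lemma summable_half_power_Suc: "summable (\<lambda>k. (1/2::real) ^ Suc k)"
  by (simp add: summable_geometric)

lemma C_dist_term_le:
  assumes "f \<in> C_space m" "g \<in> C_space m"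
  defines "N \<equiv> \<lambda>k. C_norm m (Suc k) (\<lambda>t. f t - g t)"
  shows "(1/2) ^ Suc k * (N k / (1 + N k)) \<le> C_dist m f g"
proof -
  have "summable (\<lambda>k. (1/2) ^ Suc k * (N k / (1 + N k)))"
    unfolding N_def
    by (rule summable_comparison_test'[OF summable_half_power_Suc])
      (rule C_dist_term_bounds(2)[OF assms(1,2)])
  then have "sum (\<lambda>k. (1/2) ^ Suc k * (N k / (1 + N k))) {k} \<le> C_dist m f g"
    unfolding C_dist_def N_def
    by (intro sum_le_suminf) (use C_dist_term_bounds[OF assms(1,2)] in auto)
  then show ?thesis by simp
qed

lemma C_dist_nonneg:
  assumes "f \<in> C_space m" "g \<in> C_space m"
  shows "0 \<le> C_dist m f g"
  using C_dist_term_bounds(1)[OF assms] C_dist_term_le[OF assms] by (rule order_trans)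

text \<open>The distance dominates each term of its series, so a small distance makes the norm small
  on one symmetric interval around \<open>{a..b}\<close>.\<close>

lemma uniform_limit_of_C_dist_tendsto_0:
  assumes f: "f \<in> C_space m" and G: "\<forall>\<^sub>F x in F. G x \<in> C_space m"
    and lim: "((\<lambda>x. C_dist m f (G x)) \<longlongrightarrow> 0) F" and j: "j \<le> m"
  shows "uniform_limit {a..b} (\<lambda>x. (deriv ^^ j) (G x)) ((deriv ^^ j) f) F"
proof (rule uniform_limitI)
  fix e :: real assume e: "e > 0"
  obtain k :: nat where k: "\<bar>a\<bar> + \<bar>b\<bar> \<le> real k"
    using real_arch_simple by blast
  \<comment> \<open>The threshold is the term of index \<open>k\<close> for a norm equal to
    \<open>e\<close>. As \<open>x / (1 + x)\<close> is strictly increasing for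
    \<open>x \<ge> 0\<close>, a smaller term forces a norm below \<open>e\<close>.\<close>
  have "\<forall>\<^sub>F x in F. C_dist m f (G x) < (1/2) ^ Suc k * (e / (1 + e))"
    using lim by (rule order_tendstoD) (use e in auto)
  with G show "\<forall>\<^sub>F x in F. \<forall>t\<in>{a..b}. dist ((deriv ^^ j) (G x) t) ((deriv ^^ j) f t) < e"
  proof eventually_elim
    case (elim x)
    let ?N = "C_norm m (Suc k) (\<lambda>t. f t - G x t)"
    note diff = C_space_diff[OF f elim(1)]
    have "(1/2) ^ Suc k * (?N / (1 + ?N)) < (1/2) ^ Suc k * (e / (1 + e))"
      using C_dist_term_le[OF f elim(1), of k] elim(2) by linarith
    then have "?N / (1 + ?N) < e / (1 + e)"
      by (subst (asm) mult_less_cancel_left_pos) auto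
    moreover have "0 \<le> ?N"
      by (intro C_norm_nonneg diff)
    ultimately have N: "?N < e"
      using e by (simp add: field_simps)
    show ?case
    proof
      fix t assume "t \<in> {a..b}"
      then have "t \<in> {- real (Suc k)..real (Suc k)}"
        using k by auto
      from abs_deriv_le_C_norm[OF diff(1) j this] N
      show "dist ((deriv ^^ j) (G x) t) ((deriv ^^ j) f t) < e"
        by (simp add: diff(2)[OF j] dist_real_def abs_minus_commute)
    qed
  qed
qed

text \<open>Locally uniform convergence of the derivatives sends every single norm to 0; Tannery's
  theorem with the geometric majorant then takes the limit inside the series.\<close>

lemma C_dist_tendsto_0I:
  assumes f: "f \<in> C_space m" and G: "\<forall>\<^sub>F x in F. G x \<in> C_space m"
    and lim: "\<And>j a b. j \<le> m \<Longrightarrow>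
      uniform_limit {a..b} (\<lambda>x. (deriv ^^ j) (G x)) ((deriv ^^ j) f) F"
  shows "((\<lambda>x. C_dist m f (G x)) \<longlongrightarrow> 0) F"
proof (cases "F = bot")
  case False
  let ?N = "\<lambda>k x. C_norm m (Suc k) (\<lambda>t. f t - G x t)"
  have N: "(?N k \<longlongrightarrow> 0) F" for k
  proof (rule tendstoI)
    fix e :: real assume e: "e > 0"
    let ?I = "{- real (Suc k)..real (Suc k)}"
    \<comment> \<open>The margin \<open>e / 2\<close> is needed because a strict bound on the values
      gives only a weak bound on their supremum.\<close>
    have "\<forall>\<^sub>F x in F. \<forall>j\<in>{..m}. \<forall>t\<in>?I. dist ((deriv ^^ j) (G x) t) ((deriv ^^ j) f t) < e / 2"
      by (intro eventually_ball_finite ballI uniform_limitD lim) (use e in auto)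
    with G show "\<forall>\<^sub>F x in F. dist (?N k x) 0 < e"
    proof eventually_elim
      case (elim x)
      note diff = C_space_diff[OF f elim(1)]
      have "?N k x \<le> e / 2"
        using elim(2) by (intro C_norm_le) (force simp: diff(2) dist_real_def abs_minus_commute)
      moreover have "0 \<le> ?N k x"
        by (intro C_norm_nonneg diff)
      ultimately show ?case
        using e by simp
    qed
  qed
  have "((\<lambda>x. \<Sum>k. (1/2) ^ Suc k * (?N k x / (1 + ?N k x))) \<longlongrightarrow> (\<Sum>k. 0)) F"
  proof (rule tannerys_theorem[THEN conjunct2, THEN conjunct2])
    show "((\<lambda>x. (1/2) ^ Suc k * (?N k x / (1 + ?N k x))) \<longlongrightarrow> 0) F" for k
      by (rule tendsto_eq_intros N refl | simp)+
    show "\<forall>\<^sub>F (k, x) in at_top \<times>\<^sub>F F.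
        norm ((1/2) ^ Suc k * (?N k x / (1 + ?N k x))) \<le> (1/2) ^ Suc k"
      unfolding eventually_prod_filter
      by (intro exI[of _ "\<lambda>_. True"] exI[of _ "\<lambda>x. G x \<in> C_space m"])
        (use G C_dist_term_bounds(2)[OF f] in \<open>simp del: real_norm_def power_Suc\<close>)
  qed (use False summable_half_power_Suc in auto)
  then show ?thesis
    by (simp add: C_dist_def)
qed simp

section \<open>The firing map\<close>

lemma input_classE:
  assumes "g \<in> input_class \<sigma>"
  obtains \<zeta> M where "continuous_on UNIV g" "\<zeta> > 0" "\<And>t. \<zeta> < g t - \<sigma>" "\<And>t. g t - \<sigma> < M"
  using assms unfolding input_class_def by blast

text \<open>The whole line is treated as the extended open interval from -\<infinity> to
  \<infinity>, which yields one antiderivative valid everywhere.\<close>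

lemma continuous_on_UNIV_antiderivative:
  fixes h :: "real \<Rightarrow> real"
  assumes "continuous_on UNIV h"
  obtains H where "\<And>x. (H has_real_derivative h x) (at x)"
proof -
  have "\<exists>H. \<forall>x::real. -\<infinity> < ereal x \<longrightarrow> ereal x < \<infinity> \<longrightarrow> (H has_vector_derivative h x) (at x)"
    by (rule einterval_antiderivative)
      (use assms in \<open>auto simp: continuous_on_eq_continuous_at\<close>)
  then show ?thesis
    using that by (auto simp: has_real_derivative_iff_has_vector_derivative)
qed

section \<open>The firing map of a single input\<close>

locale firing =
  fixes \<sigma> :: real and g G :: "real \<Rightarrow> real" and \<zeta> :: real
  assumes \<sigma>: "0 \<le> \<sigma>" and cont: "continuous_on UNIV g"
    and \<zeta>: "0 < \<zeta>" "\<And>t. \<zeta> < g t - \<sigma>"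
    and G: "\<And>x. (G has_real_derivative (g x - \<sigma>) * exp (\<sigma> * x)) (at x)"
begin

lemma pos: "0 < (g x - \<sigma>) * exp (\<sigma> * x)"
  using \<zeta>(1) \<zeta>(2)[of x] by simp

lemma strict_mono: "strict_mono G"
  by (rule strict_monoI, rule DERIV_pos_imp_increasing) (use G pos in auto)

lemma continuous: "continuous_on A G"
  using G by (meson DERIV_isCont continuous_at_imp_continuous_on)

text \<open>By the mean value theorem, since \<open>exp (\<sigma> * u)\<close> is smallest at
  \<open>u = t\<close>. The rate \<open>c\<close> may differ from \<open>\<zeta>\<close> and is
  required only on \<open>[t, s]\<close>, so that a nearby input can be given the rate of another
  one.\<close>

lemma increment_ge:
  assumes "t < s" "0 \<le> c" "\<And>u. t \<le> u \<Longrightarrow> u \<le> s \<Longrightarrow> c \<le> g u - \<sigma>"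
  shows "c * exp (\<sigma> * t) * (s - t) \<le> G s - G t"
proof -
  obtain z where z: "t < z" "z < s" "G s - G t = (s - t) * ((g z - \<sigma>) * exp (\<sigma> * z))"
    using MVT2[OF \<open>t < s\<close> G] by blast
  have "c * exp (\<sigma> * t) \<le> (g z - \<sigma>) * exp (\<sigma> * z)"
    using assms(2) assms(3)[of z] z \<sigma> by (intro mult_mono) (auto simp: mult_left_mono)
  then show ?thesis
    using z(3) assms(1) by (simp add: mult.commute mult_left_mono)
qed

lemma integral_eq:
  assumes "t \<le> s"
  shows "integral {t..s} (\<lambda>u. (g u - \<sigma>) * exp (\<sigma> * u)) = G s - G t"
  using assms G
  by (intro integral_unique fundamental_theorem_of_calculus)
    (auto simp flip: has_real_derivative_iff_has_vector_derivative
      intro: has_field_derivative_at_within)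

text \<open>Since \<open>G\<close> is strictly increasing, the admissible times form exactly the ray
  \<open>{s..}\<close>; its infimum is \<open>s\<close>.\<close>

lemma firing_map_eqI:
  assumes s: "G s = G t + exp (\<sigma> * t)"
  shows "firing_map \<sigma> g t = s"
proof -
  have "G t < G s"
    using s by simp
  then have "t < s"
    using strict_mono by (simp add: strict_mono_less)
  have "exp (\<sigma> * t) \<le> integral {t..r} (\<lambda>u. (g u - \<sigma>) * exp (\<sigma> * u)) \<longleftrightarrow> s \<le> r" if "t < r" for r
    using that s strict_mono_less_eq[OF strict_mono, of s r] by (auto simp: integral_eq)
  then have "{r. r > t \<and> exp (\<sigma> * t) \<le> integral {t..r} (\<lambda>u. (g u - \<sigma>) * exp (\<sigma> * u))} = {s..}"
    using \<open>t < s\<close> by auto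
  then show ?thesis
    by (simp add: firing_map_def)
qed

lemma firing_map_exists:
  assumes "t < s" "G t + exp (\<sigma> * t) \<le> G s"
  shows "\<exists>r. t \<le> r \<and> r \<le> s \<and> G r = G t + exp (\<sigma> * t)"
  using assms continuous by (intro IVT') auto

lemma G_firing_map: "G (firing_map \<sigma> g t) = G t + exp (\<sigma> * t)"
proof -
  \<comment> \<open>Over a length \<open>1/\<zeta>\<close> the guaranteed growth is just the
    required \<open>exp (\<sigma> * t)\<close>, so the intermediate value theorem yields a
    solution.\<close>
  have "\<zeta> * exp (\<sigma> * t) * (t + 1/\<zeta> - t) \<le> G (t + 1/\<zeta>) - G t"
    using \<zeta> by (intro increment_ge) (auto intro: less_imp_le)
  then have "G t + exp (\<sigma> * t) \<le> G (t + 1/\<zeta>)"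
    using \<zeta>(1) by simp
  then show ?thesis
    using firing_map_exists[of t "t + 1/\<zeta>"] \<zeta>(1) firing_map_eqI by auto
qed

lemma firing_map_gt: "t < firing_map \<sigma> g t"
proof -
  have "G t < G (firing_map \<sigma> g t)"
    by (simp add: G_firing_map)
  then show ?thesis
    using strict_mono by (simp add: strict_mono_less)
qed

lemma firing_map_le:
  assumes "0 < c" "\<And>u. t \<le> u \<Longrightarrow> u \<le> t + 1/c \<Longrightarrow> c \<le> g u - \<sigma>"
  shows "firing_map \<sigma> g t \<le> t + 1/c"
proof -
  have "c * exp (\<sigma> * t) * (t + 1/c - t) \<le> G (t + 1/c) - G t"
    using assms by (intro increment_ge) auto
  then have "G (firing_map \<sigma> g t) \<le> G (t + 1/c)"
    using assms(1) by (simp add: G_firing_map)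
  then show ?thesis
    using strict_mono by (simp add: strict_mono_less_eq)
qed

text \<open>Inverting \<open>G\<close> in \<open>G_firing_map\<close> presents the firing map as
  \<open>L (G t + exp (\<sigma> * t))\<close>, to which the chain rule applies.\<close>

lemma DERIV_firing_map:
  "(firing_map \<sigma> g has_real_derivative
     g t * exp (\<sigma> * (t - firing_map \<sigma> g t)) / (g (firing_map \<sigma> g t) - \<sigma>)) (at t)"
proof -
  define s where "s = firing_map \<sigma> g t"
  define L where "L = the_inv G"
  have L: "L (G x) = x" for x
    unfolding L_def using strict_mono by (simp add: the_inv_f_f strict_mono_imp_inj_on)
  have eq: "firing_map \<sigma> g = (\<lambda>t. L (G t + exp (\<sigma> * t)))"
    using L by (metis G_firing_map)
  have contG: "isCont G x" for x
    using G by (rule DERIV_isCont)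
  have "(L has_real_derivative inverse ((g s - \<sigma>) * exp (\<sigma> * s))) (at (G s))"
  proof (rule DERIV_inverse_function)
    show "(G has_real_derivative (g s - \<sigma>) * exp (\<sigma> * s)) (at (L (G s)))"
      using G by (simp add: L)
    show "(g s - \<sigma>) * exp (\<sigma> * s) \<noteq> 0"
      using pos[of s] by linarith
    show "G (s - 1) < G s" "G s < G (s + 1)"
      using strict_mono by (simp_all add: strict_mono_less)
    \<comment> \<open>\<open>G\<close> need not be onto, and \<open>L\<close> is unspecified off its
      range; the intermediate value theorem places all \<open>y\<close> near \<open>G s\<close> in
      the range.\<close>
    show "G (L y) = y" if y: "G (s - 1) < y" "y < G (s + 1)" for y
    proof -
      have "\<exists>x. s - 1 \<le> x \<and> x \<le> s + 1 \<and> G x = y"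
        using y continuous by (intro IVT') auto
      then show ?thesis
        using L by auto
    qed
    show "isCont L (G s)"
      by (rule isCont_inverse_function[where d = 1]) (use L contG in auto)
  qed
  then have "(L has_real_derivative inverse ((g s - \<sigma>) * exp (\<sigma> * s))) (at (G t + exp (\<sigma> * t)))"
    by (simp add: s_def G_firing_map)
  \<comment> \<open>The term \<open>-\<sigma>\<close> in the derivative of \<open>G\<close> cancels
    against the derivative of the exponential, leaving \<open>g t\<close> as the numerator.\<close>
  moreover have "((\<lambda>t. G t + exp (\<sigma> * t)) has_real_derivative g t * exp (\<sigma> * t)) (at t)"
    by (rule derivative_eq_intros G refl | simp add: algebra_simps)+
  ultimately have "(firing_map \<sigma> g has_real_derivative
      inverse ((g s - \<sigma>) * exp (\<sigma> * s)) * (g t * exp (\<sigma> * t))) (at t)"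
    unfolding eq by (rule DERIV_chain2)
  moreover have "inverse ((g s - \<sigma>) * exp (\<sigma> * s)) * (g t * exp (\<sigma> * t)) =
      g t * exp (\<sigma> * (t - s)) / (g s - \<sigma>)"
    by (simp add: field_simps exp_diff)
  ultimately show ?thesis
    by (simp add: s_def)
qed

lemma deriv_firing_map:
  "deriv (firing_map \<sigma> g) =
     (\<lambda>t. g t * exp (\<sigma> * (t - firing_map \<sigma> g t)) / (g (firing_map \<sigma> g t) - \<sigma>))"
  using DERIV_firing_map by (auto intro!: DERIV_imp_deriv)

lemma continuous_on_firing_map: "continuous_on A (firing_map \<sigma> g)"
  using DERIV_firing_map by (meson DERIV_isCont continuous_at_imp_continuous_on)

lemma continuous_on_comp_firing_map: "continuous_on A (\<lambda>t. g (firing_map \<sigma> g t))"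
  by (rule continuous_on_compose2[OF cont continuous_on_firing_map]) auto

lemma firing_map_in_C_space: "firing_map \<sigma> g \<in> C_space 1"
proof -
  have "g t \<noteq> \<sigma>" for t
    using \<zeta>(1) \<zeta>(2)[of t] by auto
  then have "continuous_on UNIV (deriv (firing_map \<sigma> g))"
    unfolding deriv_firing_map
    by (auto intro!: continuous_intros cont continuous_on_firing_map continuous_on_comp_firing_map)
  moreover have "firing_map \<sigma> g differentiable at t" for t
    using DERIV_firing_map real_differentiable_def by blast
  ultimately show ?thesis
    by (auto simp: C_space_def le_Suc_eq continuous_on_firing_map)
qed

end

section \<open>Dependence of the firing map on the input\<close>

lemma firing_existence:
  assumes "0 \<le> \<sigma>" "g \<in> input_class \<sigma>"
  obtains G \<zeta> where "firing \<sigma> g G \<zeta>"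
proof -
  obtain \<zeta> M where g: "continuous_on UNIV g" "\<zeta> > 0" "\<And>t. \<zeta> < g t - \<sigma>"
    using assms(2) by (rule input_classE) blast
  obtain G where "\<And>x. (G has_real_derivative (g x - \<sigma>) * exp (\<sigma> * x)) (at x)"
    by (rule continuous_on_UNIV_antiderivative[of "\<lambda>x. (g x - \<sigma>) * exp (\<sigma> * x)"])
      (auto intro!: continuous_intros g)
  then show ?thesis
    using that g assms(1) by (blast intro: firing.intro)
qed

text \<open>Between the two firing times \<open>H\<close> changes by the increment of
  \<open>H - G\<close> from \<open>t\<close> to \<open>b\<close>, of order \<open>d\<close>, but it
  grows at least at the rate \<open>\<zeta> * exp (\<sigma> * t)\<close>. The bounds involve only
  the constant of \<open>f\<close>, hence are uniform in \<open>g\<close>.\<close>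

lemma firing_map_diff_le:
  assumes "firing \<sigma> f H \<zeta>" "firing \<sigma> g G \<zeta>'"
    and d: "d \<le> \<zeta> / 2" "\<And>u. t \<le> u \<Longrightarrow> u \<le> t + 2/\<zeta> \<Longrightarrow> \<bar>f u - g u\<bar> \<le> d"
  shows "\<bar>firing_map \<sigma> f t - firing_map \<sigma> g t\<bar> \<le> d * (2/\<zeta> * exp (\<sigma> * (2/\<zeta>)) / \<zeta>)"
    and "firing_map \<sigma> g t \<le> t + 2/\<zeta>"
proof -
  interpret f: firing \<sigma> f H \<zeta> by fact
  interpret g: firing \<sigma> g G \<zeta>' by fact
  define a b where "a = firing_map \<sigma> f t" and "b = firing_map \<sigma> g t"
  \<comment> \<open>With \<open>d \<le> \<zeta>/2\<close>, closeness to \<open>f\<close> keeps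
    \<open>g - \<sigma>\<close> above \<open>\<zeta>/2\<close> for as long as \<open>g\<close> needs
    to fire.\<close>
  have "b \<le> t + 1/(\<zeta>/2)"
    unfolding b_def
  proof (rule g.firing_map_le)
    show "\<zeta>/2 \<le> g u - \<sigma>" if "t \<le> u" "u \<le> t + 1/(\<zeta>/2)" for u
      using d(1) d(2)[of u] f.\<zeta>(2)[of u] that by auto
  qed (use f.\<zeta> in auto)
  then have b: "t < b" "b \<le> t + 2/\<zeta>"
    using g.firing_map_gt by (auto simp: b_def)
  then show "firing_map \<sigma> g t \<le> t + 2/\<zeta>"
    by (simp add: b_def)
  have "0 \<le> \<bar>f t - g t\<bar>" "\<bar>f t - g t\<bar> \<le> d"
    using d(2)[of t] f.\<zeta>(1) by auto
  then have "0 \<le> d"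
    by linarith
  have a: "t < a"
    using f.firing_map_gt by (simp add: a_def)
  have "((\<lambda>u. H u - G u) has_real_derivative (f u - g u) * exp (\<sigma> * u)) (at u)" for u
    by (rule derivative_eq_intros f.G g.G refl | simp add: algebra_simps)+
  from MVT2[OF b(1) this]
  obtain z where z: "t < z" "z < b" "H b - G b - (H t - G t) = (b - t) * ((f z - g z) * exp (\<sigma> * z))"
    by blast
  \<comment> \<open>Subtracting the firing equations for \<open>H\<close> at \<open>a\<close> and
    \<open>G\<close> at \<open>b\<close> cancels both terms
    \<open>exp (\<sigma> * t)\<close>.\<close>
  have "H b - H a = (b - t) * ((f z - g z) * exp (\<sigma> * z))"
    using f.G_firing_map[of t] g.G_firing_map[of t] z(3) by (simp add: a_def b_def)
  then have "\<bar>H b - H a\<bar> = (b - t) * (\<bar>f z - g z\<bar> * exp (\<sigma> * z))"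
    using b(1) by (simp add: abs_mult)
  also have "\<dots> \<le> 2/\<zeta> * (d * exp (\<sigma> * (t + 2/\<zeta>)))"
    using b z f.\<zeta>(1) f.\<sigma> \<open>0 \<le> d\<close> by (intro mult_mono d(2)) (auto simp: mult_left_mono)
  finally have upper: "\<bar>H b - H a\<bar> \<le> 2/\<zeta> * (d * exp (\<sigma> * (t + 2/\<zeta>)))" .
  \<comment> \<open>The rate is taken at \<open>t\<close>, not at \<open>r\<close>, so that it
    serves both orders of \<open>a\<close> and \<open>b\<close>.\<close>
  have lower: "\<zeta> * exp (\<sigma> * t) * (s - r) \<le> H s - H r" if "t \<le> r" "r < s" for r s
  proof -
    have "\<zeta> * exp (\<sigma> * t) * (s - r) \<le> \<zeta> * exp (\<sigma> * r) * (s - r)"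
      using that f.\<zeta>(1) f.\<sigma> by (intro mult_right_mono mult_left_mono) (auto simp: mult_left_mono)
    also have "\<dots> \<le> H s - H r"
      using that f.\<zeta> by (intro f.increment_ge) (auto intro: less_imp_le)
    finally show ?thesis .
  qed
  have "\<zeta> * exp (\<sigma> * t) * \<bar>b - a\<bar> \<le> \<bar>H b - H a\<bar>"
    using lower[of a b] lower[of b a] a b by (cases a b rule: linorder_cases) auto
  with upper have "\<zeta> * exp (\<sigma> * t) * \<bar>b - a\<bar> \<le> 2/\<zeta> * (d * exp (\<sigma> * (t + 2/\<zeta>)))"
    by linarith
  \<comment> \<open>Splitting off \<open>exp (\<sigma> * t)\<close> lets it cancel, so the final
    constant does not depend on \<open>t\<close>.\<close>
  also have "\<dots> = \<zeta> * exp (\<sigma> * t) * (d * (2/\<zeta> * exp (\<sigma> * (2/\<zeta>)) / \<zeta>))"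
    using f.\<zeta>(1) by (simp add: distrib_left exp_add)
  finally show "\<bar>a - b\<bar> \<le> d * (2/\<zeta> * exp (\<sigma> * (2/\<zeta>)) / \<zeta>)"
    using f.\<zeta>(1) by (subst (asm) mult_le_cancel_left_pos) (auto simp: abs_minus_commute)
qed

text \<open>\<open>T\<close> is \<open>2/\<zeta>\<close> for the constant of \<open>f\<close>. The
  first conclusion provides a common compact interval for the firing times, as composition with the
  varying inputs requires.\<close>

lemma uniform_limit_firing_map:
  assumes "0 \<le> \<sigma>" "f \<in> input_class \<sigma>"
    and G: "\<forall>\<^sub>F x in F. G x \<in> input_class \<sigma>"
    and lim: "\<And>a b. uniform_limit {a..b} G f F"
  obtains T where
    "\<And>a b. \<forall>\<^sub>F x in F. \<forall>t\<in>{a..b}. firing_map \<sigma> (G x) t \<in> {a..b + T}"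
    "\<And>a b. uniform_limit {a..b} (\<lambda>x. firing_map \<sigma> (G x)) (firing_map \<sigma> f) F"
proof -
  obtain H \<zeta> where "firing \<sigma> f H \<zeta>"
    using assms by (elim firing_existence)
  then interpret f: firing \<sigma> f H \<zeta> .
  define C where "C = 2/\<zeta> * exp (\<sigma> * (2/\<zeta>)) / \<zeta>"
  have C: "C > 0"
    using f.\<zeta>(1) by (simp add: C_def)
  have key: "\<forall>\<^sub>F x in F. \<forall>t\<in>{a..b}. \<bar>firing_map \<sigma> f t - firing_map \<sigma> (G x) t\<bar> \<le> d * C \<and>
      firing_map \<sigma> (G x) t \<in> {a..b + 2/\<zeta>}" if d: "0 < d" "d \<le> \<zeta>/2" for a b d
    using G uniform_limitD[OF lim[of a "b + 2/\<zeta>"] d(1)]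
  proof eventually_elim
    case (elim x)
    obtain K \<zeta>' where g: "firing \<sigma> (G x) K \<zeta>'"
      using assms(1) elim(1) by (elim firing_existence)
    show ?case
    proof
      fix t assume t: "t \<in> {a..b}"
      have "\<bar>f u - G x u\<bar> \<le> d" if "t \<le> u" "u \<le> t + 2/\<zeta>" for u
        using bspec[OF elim(2), of u] t that by (auto simp: dist_real_def abs_minus_commute)
      note close = firing_map_diff_le[of \<sigma> f H \<zeta> "G x" K \<zeta>' d t, OF f.firing_axioms g d(2) this]
      show "\<bar>firing_map \<sigma> f t - firing_map \<sigma> (G x) t\<bar> \<le> d * C \<and>
          firing_map \<sigma> (G x) t \<in> {a..b + 2/\<zeta>}"
        using close t firing.firing_map_gt[OF g, of t] by (auto simp: C_def)
    qed
  qed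
  show thesis
  proof
    show "\<forall>\<^sub>F x in F. \<forall>t\<in>{a..b}. firing_map \<sigma> (G x) t \<in> {a..b + 2/\<zeta>}" for a b
      using key[of "\<zeta>/2" a b] f.\<zeta>(1) by (auto elim!: eventually_mono)
    show "uniform_limit {a..b} (\<lambda>x. firing_map \<sigma> (G x)) (firing_map \<sigma> f) F" for a b
    proof (rule uniform_limitI)
      fix e :: real assume e: "e > 0"
      \<comment> \<open>The first entry makes the comparison estimate applicable, the second gives
        \<open>d * C \<le> e / 2\<close>.\<close>
      define d where "d = min (\<zeta>/2) (e / (2 * C))"
      have "d * C \<le> e / (2 * C) * C"
        using C by (intro mult_right_mono) (auto simp: d_def)
      then have d: "0 < d" "d \<le> \<zeta>/2" "d * C < e"
        using C e f.\<zeta>(1) by (auto simp: d_def)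
      show "\<forall>\<^sub>F x in F. \<forall>t\<in>{a..b}. dist (firing_map \<sigma> (G x) t) (firing_map \<sigma> f t) < e"
        using key[OF d(1,2), of a b]
        by (rule eventually_mono) (use d(3) in \<open>force simp: dist_real_def abs_minus_commute\<close>)
    qed
  qed
qed

text \<open>Compare through \<open>f (P x t)\<close>: uniform convergence on \<open>K\<close>
  handles the change of function, uniform continuity of \<open>f\<close> the change of
  argument.\<close>

lemma uniform_limit_compose_moving:
  fixes f :: "'b::metric_space \<Rightarrow> 'c::metric_space"
  assumes G: "uniform_limit K G f F" and f: "uniformly_continuous_on K f"
    and P: "uniform_limit S P p F" "\<forall>\<^sub>F x in F. P x ` S \<subseteq> K" "p ` S \<subseteq> K"
  shows "uniform_limit S (\<lambda>x t. G x (P x t)) (\<lambda>t. f (p t)) F"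
proof (rule uniform_limitI)
  fix e :: real assume e: "e > 0"
  have "uniform_limit S (\<lambda>x t. f (P x t)) (f \<circ> p) F"
    by (rule uniform_limit_compose[OF P(1) f P(2,3)])
  from uniform_limitD[OF this half_gt_zero[OF e]] uniform_limitD[OF G half_gt_zero[OF e]] P(2)
  show "\<forall>\<^sub>F x in F. \<forall>t\<in>S. dist (G x (P x t)) (f (p t)) < e"
  proof eventually_elim
    case (elim x)
    show ?case
    proof
      fix t assume "t \<in> S"
      then have "dist (G x (P x t)) (f (P x t)) < e / 2" "dist (f (P x t)) (f (p t)) < e / 2"
        using elim by auto
      then show "dist (G x (P x t)) (f (p t)) < e"
        using dist_triangle[of "G x (P x t)" "f (p t)" "f (P x t)"] by linarith
    qed
  qed
qed

text \<open>The limit is taken in the explicit derivative formula. Products need bounded limit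
  functions, supplied by compactness; the quotient needs a limit denominator bounded away from 0,
  supplied by \<open>\<zeta>\<close>.\<close>

lemma uniform_limit_deriv_firing_map:
  assumes \<sigma>: "0 \<le> \<sigma>" and f: "f \<in> input_class \<sigma>"
    and G: "\<forall>\<^sub>F x in F. G x \<in> input_class \<sigma>"
    and lim: "\<And>a b. uniform_limit {a..b} G f F"
  shows "uniform_limit {a..b} (\<lambda>x. deriv (firing_map \<sigma> (G x))) (deriv (firing_map \<sigma> f)) F"
proof -
  obtain H \<zeta> where "firing \<sigma> f H \<zeta>"
    using \<sigma> f by (elim firing_existence)
  then interpret f: firing \<sigma> f H \<zeta> .
  let ?P = "\<lambda>x. firing_map \<sigma> (G x)" and ?p = "firing_map \<sigma> f"
  obtain T where T: "\<And>a b. \<forall>\<^sub>F x in F. \<forall>t\<in>{a..b}. ?P x t \<in> {a..b + T}"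
    and P: "\<And>a b. uniform_limit {a..b} ?P ?p F"
    using uniform_limit_firing_map[OF assms] by blast
  have bounded: "bounded (h ` {a..b})" if "continuous_on {a..b} h" for h :: "real \<Rightarrow> real"
    using that by (intro compact_imp_bounded compact_continuous_image) auto
  have cont_f: "continuous_on A f" for A
    using f.cont continuous_on_subset by blast
  obtain B where B: "\<And>t. t \<in> {a..b} \<Longrightarrow> \<bar>?p t\<bar> \<le> B"
    using bounded[OF f.continuous_on_firing_map] by (force simp: bounded_iff)
  have moving: "uniform_limit {a..b} (\<lambda>x t. h' x (?P x t)) (\<lambda>t. h (?p t)) F"
    if "\<And>a b. uniform_limit {a..b} h' h F" "continuous_on UNIV h" for h h'
  proof (rule uniform_limit_compose_moving[OF that(1)])
    \<comment> \<open>\<open>?K\<close> contains both \<open>{a..b + T}\<close>, where the varying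
      firing times eventually lie, and \<open>{-B..B}\<close>, which holds those of
      \<open>f\<close>.\<close>
    let ?K = "{min a (-B)..max (b + T) B}"
    show "uniformly_continuous_on ?K h"
      by (intro compact_uniformly_continuous continuous_on_subset[OF that(2)]) auto
    show "\<forall>\<^sub>F x in F. ?P x ` {a..b} \<subseteq> ?K"
      using T[of a b] by (rule eventually_mono) force
    show "?p ` {a..b} \<subseteq> ?K"
      using B by (force simp: abs_le_iff)
  qed (rule P)
  have comp: "uniform_limit {a..b} (\<lambda>x t. G x (?P x t)) (\<lambda>t. f (?p t)) F"
    by (rule moving[OF lim f.cont])
  \<comment> \<open>\<open>moving\<close> treats functions of the firing time alone, so the factor
    depending directly on \<open>t\<close> is separated first.\<close>
  have "uniform_limit {a..b} (\<lambda>x t. exp (\<sigma> * t) * exp (- (\<sigma> * ?P x t)))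
      (\<lambda>t. exp (\<sigma> * t) * exp (- (\<sigma> * ?p t))) F"
    by (intro uniform_lim_mult uniform_limit_const bounded continuous_intros
        f.continuous_on_firing_map moving[of "\<lambda>_ u. exp (- (\<sigma> * u))"])
  then have exponent: "uniform_limit {a..b} (\<lambda>x t. exp (\<sigma> * (t - ?P x t))) (\<lambda>t. exp (\<sigma> * (t - ?p t))) F"
    by (simp add: right_diff_distrib flip: exp_add)
  have "uniform_limit {a..b}
      (\<lambda>x t. G x t * exp (\<sigma> * (t - ?P x t)) / (G x (?P x t) - \<sigma>))
      (\<lambda>t. f t * exp (\<sigma> * (t - ?p t)) / (f (?p t) - \<sigma>)) F"
  proof (rule uniform_lim_divide)
    show "uniform_limit {a..b} (\<lambda>x t. G x t * exp (\<sigma> * (t - ?P x t)))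
        (\<lambda>t. f t * exp (\<sigma> * (t - ?p t))) F"
      by (intro uniform_lim_mult lim exponent bounded continuous_intros cont_f
          f.continuous_on_firing_map)
    show "uniform_limit {a..b} (\<lambda>x t. G x (?P x t) - \<sigma>) (\<lambda>t. f (?p t) - \<sigma>) F"
      by (intro uniform_limit_intros comp)
    show "bounded ((\<lambda>t. f t * exp (\<sigma> * (t - ?p t))) ` {a..b})"
      by (intro bounded continuous_intros cont_f f.continuous_on_firing_map)
    show "\<zeta> \<le> norm (f (?p t) - \<sigma>)" for t
      using f.\<zeta>(2)[of "?p t"] by simp
  qed (rule f.\<zeta>(1))
  moreover have "\<forall>\<^sub>F x in F. deriv (?P x) = (\<lambda>t. G x t * exp (\<sigma> * (t - ?P x t)) / (G x (?P x t) - \<sigma>))"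
    using G by (rule eventually_mono) (metis firing.deriv_firing_map firing_existence \<sigma>)
  ultimately show ?thesis
    unfolding f.deriv_firing_map
    by (subst uniform_limit_cong) (auto elim!: eventually_mono)
qed

section \<open>Continuity of the firing map in its input\<close>

theorem proposition2p9:
  fixes \<sigma> :: real
  assumes "\<sigma> \<ge> 0"
  shows "firing_map \<sigma> \<in> input_class \<sigma> \<rightarrow> C_space 1 \<and>
    (\<forall>f\<in>input_class \<sigma>. \<forall>\<epsilon>>0. \<exists>\<delta>>0. \<forall>g\<in>input_class \<sigma>.
       C_dist 0 f g < \<delta> \<longrightarrow> C_dist 1 (firing_map \<sigma> f) (firing_map \<sigma> g) < \<epsilon>)"
proof (intro conjI ballI allI impI)
  have C1: "firing_map \<sigma> g \<in> C_space 1" if "g \<in> input_class \<sigma>" for g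
    using assms that by (metis firing.firing_map_in_C_space firing_existence)
  then show "firing_map \<sigma> \<in> input_class \<sigma> \<rightarrow> C_space 1"
    by blast
  have C0: "g \<in> C_space 0" if "g \<in> input_class \<sigma>" for g
    using that by (auto simp: C_space_def input_class_def)
  fix f and \<epsilon> :: real assume f: "f \<in> input_class \<sigma>" and \<epsilon>: "\<epsilon> > 0"
  \<comment> \<open>\<open>F\<close> encodes \<open>g\<close> tending to \<open>f\<close> within the
    input class: pulling back the neighbourhoods of 0 along the distance turns limits along
    \<open>F\<close> into the required statement with \<open>\<epsilon>\<close> and
    \<open>\<delta>\<close>.\<close>
  define F where "F = inf (filtercomap (C_dist 0 f) (nhds 0)) (principal (input_class \<sigma>))"
  have in_class: "\<forall>\<^sub>F g in F. g \<in> input_class \<sigma>"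
    by (simp add: F_def eventually_inf_principal)
  have "(C_dist 0 f \<longlongrightarrow> 0) F"
    unfolding F_def by (rule tendsto_mono[OF inf_le1 filterlim_filtercomap])
  moreover have "\<forall>\<^sub>F g in F. g \<in> C_space 0"
    using in_class C0 by (rule eventually_mono)
  ultimately have lim: "uniform_limit {a..b} (\<lambda>g. g) f F" for a b
    using uniform_limit_of_C_dist_tendsto_0[OF C0[OF f], of "\<lambda>g. g" F 0 a b] by simp
  have "((\<lambda>g. C_dist 1 (firing_map \<sigma> f) (firing_map \<sigma> g)) \<longlongrightarrow> 0) F"
  proof (rule C_dist_tendsto_0I)
    show "firing_map \<sigma> f \<in> C_space 1" "\<forall>\<^sub>F g in F. firing_map \<sigma> g \<in> C_space 1"
      using C1 f in_class by (auto elim: eventually_mono)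
    fix j :: nat and a b :: real assume "j \<le> 1"
    then consider "j = 0" | "j = 1" by linarith
    then show "uniform_limit {a..b} (\<lambda>g. (deriv ^^ j) (firing_map \<sigma> g))
        ((deriv ^^ j) (firing_map \<sigma> f)) F"
    proof cases
      case 1
      then show ?thesis
        using uniform_limit_firing_map[OF assms f in_class lim] by auto
    next
      case 2
      then show ?thesis
        using uniform_limit_deriv_firing_map[OF assms f in_class lim] by auto
    qed
  qed
  then have "\<forall>\<^sub>F g in F. C_dist 1 (firing_map \<sigma> f) (firing_map \<sigma> g) < \<epsilon>"
    using \<epsilon> by (rule order_tendstoD)
  then obtain \<delta> where \<delta>: "\<delta> > 0"
    "\<And>g. g \<in> input_class \<sigma> \<Longrightarrow> \<bar>C_dist 0 f g\<bar> < \<delta> \<Longrightarrow>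
       C_dist 1 (firing_map \<sigma> f) (firing_map \<sigma> g) < \<epsilon>"
    unfolding F_def eventually_inf_principal eventually_filtercomap eventually_nhds_metric
    by (auto simp: dist_real_def)
  show "\<exists>\<delta>>0. \<forall>g\<in>input_class \<sigma>. C_dist 0 f g < \<delta> \<longrightarrow>
      C_dist 1 (firing_map \<sigma> f) (firing_map \<sigma> g) < \<epsilon>"
    \<comment> \<open>Nonnegativity of the distance removes the absolute value left by the
      neighbourhoods of 0.\<close>
    using \<delta> C_dist_nonneg[OF C0[OF f] C0] by (intro exI[of _ \<delta>]) auto
qed

end
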